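(* Let $m\ge 2$ and let $S=\langle m,s+1,s+2,\dots,s+m-1\rangle$ be an Arf numerical semigroup with multiplicity $m$ and conductor $s$, where $s\equiv 0\bmod m$. Let $A=(a_{ij})_{m\times m}$ be the row-factorization matrix of the Frobenius number $s-1$ given by $a_{ii}=-1$ for all $i$, $a_{1m}=1$, $a_{21}=\frac{2s}{m}$, $a_{i1}=\frac{s}{m}$ and $a_{i,i-1}=1$ for $3\le i\le m$, and all other entries $0$. Then $|\det A|=s-1$.
   Context: A numerical semigroup is a subset $S\subseteq\mathbb{N}_0$ (non-negative integers) containing $0$, closed under addition, with finite complement in $\mathbb{N}_0$; $\langle A\rangle$ is the set of $\mathbb{N}_0$-linear combinations of elements of $A$. The multiplicity is the smallest nonzero element of $S$; the Frobenius number $F(S)$ is the greatest integer not in $S$; the conductor is $F(S)+1$. $S$ is Arf if $s_2+s_3-s_1\in S$ for all $s_1\le s_2\le s_3$ in $S$. If $n_1<\dots<n_e$ are the minimal generators of $S$, a row-factorization matrix of $F(S)$ is an $e\times e$ integer matrix $[a_{ij}]$ with $a_{ii}=-1$, $a_{ij}\in\mathbb{N}_0$ for $i\ne j$, and $F(S)=\sum_{j=1}^e a_{ij}n_j$ for each $i$. *)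

theory Defs
  imports "HOL-Number_Theory.Cong" "Jordan_Normal_Form.Determinant"
begin

definition numerical_semigroup :: "nat set \<Rightarrow> bool" where
  "numerical_semigroup S \<longleftrightarrow>
     0 \<in> S \<and> (\<forall>x\<in>S. \<forall>y\<in>S. x + y \<in> S) \<and> finite (- S)"

definition generated :: "nat set \<Rightarrow> nat set"  ("\<langle>_\<rangle>") where
  "\<langle>A\<rangle> = {\<Sum>a\<in>T. c a * a | T c. finite T \<and> T \<subseteq> A}"

definition multiplicity_of :: "nat set \<Rightarrow> nat" where
  "multiplicity_of S = (LEAST n. n \<in> S \<and> n \<noteq> 0)"

text \<open>The Frobenius number ranges over the integers, so that it is \<open>- 1\<close> for \<open>S = UNIV\<close>.\<close>

definition frobenius_number :: "nat set \<Rightarrow> int" where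
  "frobenius_number S = (GREATEST z. z \<notin> int ` S)"

definition conductor :: "nat set \<Rightarrow> int" where
  "conductor S = frobenius_number S + 1"

text \<open>The natural-number subtraction below never truncates, because \<open>s1 \<le> s2\<close>.\<close>

definition Arf :: "nat set \<Rightarrow> bool" where
  "Arf S \<longleftrightarrow>
     (\<forall>s1\<in>S. \<forall>s2\<in>S. \<forall>s3\<in>S. s1 \<le> s2 \<and> s2 \<le> s3 \<longrightarrow> s2 + s3 - s1 \<in> S)"

definition minimal_generating_set :: "nat set \<Rightarrow> nat set \<Rightarrow> bool" where
  "minimal_generating_set A S \<longleftrightarrow> \<langle>A\<rangle> = S \<and> (\<forall>B. B \<subset> A \<longrightarrow> \<langle>B\<rangle> \<noteq> S)"

text \<open>
  The list \<open>ns\<close> enumerates the minimal generators increasingly. A numerical semigroup has exactly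
  one minimal generating set and it is finite, so \<open>ns\<close> is determined by \<open>S\<close>.
\<close>

definition row_factorization_matrix :: "nat set \<Rightarrow> int mat \<Rightarrow> bool" where
  "row_factorization_matrix S A \<longleftrightarrow>
     (\<exists>ns. sorted_wrt (<) ns \<and> minimal_generating_set (set ns) S \<and>
        A \<in> carrier_mat (length ns) (length ns) \<and>
        (\<forall>i<length ns. A $$ (i, i) = -1) \<and>
        (\<forall>i<length ns. \<forall>j<length ns. i \<noteq> j \<longrightarrow> A $$ (i, j) \<ge> 0) \<and>
        (\<forall>i<length ns. frobenius_number S = (\<Sum>j<length ns. A $$ (i, j) * int (ns ! j))))"

text \<open>
  The indices \<open>i\<close>, \<open>j\<close> of \<open>rf_entry\<close> run from \<open>1\<close> to \<open>m\<close>; library matrices are indexed from \<open>0\<close>.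
  The integer divisions are exact when \<open>m\<close> divides \<open>s\<close>.
\<close>

definition rf_entry :: "nat \<Rightarrow> nat \<Rightarrow> nat \<Rightarrow> nat \<Rightarrow> int" where
  "rf_entry m s i j =
     (if i = j then -1
      else if i = 1 \<and> j = m then 1
      else if i = 2 \<and> j = 1 then int (2 * s) div int m
      else if 3 \<le> i \<and> j = 1 then int s div int m
      else if 3 \<le> i \<and> j = i - 1 then 1
      else 0)"

definition rf_mat :: "nat \<Rightarrow> nat \<Rightarrow> int mat" where
  "rf_mat m s = mat m m (\<lambda>(i, j). rf_entry m s (i + 1) (j + 1))"

end

theory Submission imports Defs begin

text \<open>
  Write \<open>s = k * m\<close>. Since \<open>1\<close> does not lie in \<open>S\<close>, we have \<open>k > 0\<close>, hence \<open>s \<ge> m\<close>.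

  Each of the listed generators is an atom of \<open>S\<close>: it is not a sum of two nonzero elements of \<open>S\<close>.
  Indeed every element of \<open>S\<close> is a multiple of \<open>m\<close> or exceeds \<open>s\<close>, and every nonzero element is at
  least \<open>m\<close>. So a sum of two nonzero elements is either a multiple of \<open>m\<close> that is at least \<open>2 * m\<close>,
  or greater than \<open>s + m\<close>; no listed generator is of this kind. As atoms belong to every
  generating set, the listed generators form the minimal one. With this, the row-factorization
  property is an evaluation of the row sums of the matrix against the generators.

  For the determinant, add to the first column the combination of the other columns that clears
  everything below the top entry. The lower right block of the matrix is bidiagonal, with \<open>-1\<close> on
  the diagonal and \<open>1\<close> below it, so the coefficients are found by forward substitution: they are
  \<open>2 * k, 3 * k, \<dots>, m * k\<close>. The top entry becomes \<open>m * k - 1 = s - 1\<close>, and the remaining minor is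
  triangular with all diagonal entries \<open>-1\<close>. Both computations rest on one formula for
  the product of a row of the matrix with an arbitrary vector (\<open>rf_row_sum\<close>).
\<close>

lemma generated_superset: "A \<subseteq> \<langle>A\<rangle>"
proof
  fix a assume "a \<in> A"
  moreover have "a = (\<Sum>x\<in>{a}. 1 * x)" by simp
  ultimately show "a \<in> \<langle>A\<rangle>"
    unfolding generated_def by (intro CollectI exI[of _ "{a}"] exI[of _ "\<lambda>_. 1"]) auto
qed

text \<open>
  An atom lies in every generating set: split off one generator from a representation of \<open>g\<close>;
  the remainder must vanish.
\<close>

lemma atom_in_generating_set:
  assumes g: "g \<in> \<langle>B\<rangle>" "g \<noteq> 0"
    and atom: "\<And>x y. x \<in> \<langle>B\<rangle> \<Longrightarrow> y \<in> \<langle>B\<rangle> \<Longrightarrow> g = x + y \<Longrightarrow> x = 0 \<or> y = 0"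
  shows "g \<in> B"
proof -
  obtain T c where T: "finite T" "T \<subseteq> B" and gsum: "g = (\<Sum>a\<in>T. c a * a)"
    using g(1) unfolding generated_def by blast
  obtain a where a: "a \<in> T" "c a * a \<noteq> 0"
    using g(2) unfolding gsum by (rule sum.not_neutral_contains_not_neutral)
  define c' where "c' = c(a := c a - 1)"
  define r where "r = (\<Sum>x\<in>T. c' x * x)"
  have r: "r \<in> \<langle>B\<rangle>" using T unfolding r_def generated_def by blast
  have "(\<Sum>x\<in>T - {a}. c' x * x) = (\<Sum>x\<in>T - {a}. c x * x)"
    by (rule sum.cong) (auto simp: c'_def)
  moreover have "c a * a = a + c' a * a"
    using a(2) by (cases "c a") (auto simp: c'_def)
  ultimately have "g = a + r"
    unfolding gsum r_def using T(1) a(1) by (simp add: sum.remove)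
  moreover have "a \<in> \<langle>B\<rangle>" "a \<in> B" "a \<noteq> 0"
    using a T(2) generated_superset by auto
  ultimately show ?thesis using atom[OF _ r] by force
qed

lemma minimal_generating_setI_atoms:
  assumes "\<langle>A\<rangle> = S" and "0 \<notin> A"
    and atom: "\<And>g x y. g \<in> A \<Longrightarrow> x \<in> S \<Longrightarrow> y \<in> S \<Longrightarrow> g = x + y \<Longrightarrow> x = 0 \<or> y = 0"
  shows "minimal_generating_set A S"
  unfolding minimal_generating_set_def
proof (intro conjI allI impI notI)
  fix B assume B: "B \<subset> A" "\<langle>B\<rangle> = S"
  then obtain g where g: "g \<in> A" "g \<notin> B" by blast
  have "g \<in> S" using g(1) generated_superset unfolding assms(1)[symmetric] by blast
  moreover have "g \<noteq> 0" using g(1) assms(2) by metis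
  ultimately have "g \<in> B"
    using atom_in_generating_set[of g B, unfolded B(2)] atom[OF g(1)] by simp
  with g(2) show False by simp
qed (fact assms(1))

text \<open>
  If a generator other than \<open>m\<close> occurs in a representation of \<open>z\<close>, it already exceeds \<open>s\<close>;
  otherwise only multiples of \<open>m\<close> are added.
\<close>

lemma generated_dvd_or_greater:
  fixes m s :: nat
  assumes z: "z \<in> \<langle>{m} \<union> G\<rangle>" and G: "\<And>a. a \<in> G \<Longrightarrow> s < a"
  shows "m dvd z \<or> s < z"
proof -
  obtain T c where T: "finite T" "T \<subseteq> {m} \<union> G" and zsum: "z = (\<Sum>a\<in>T. c a * a)"
    using z unfolding generated_def by blast
  show ?thesis
  proof (cases "\<exists>a\<in>T. a \<noteq> m \<and> c a \<noteq> 0")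
    case True
    then obtain a where a: "a \<in> T" "a \<noteq> m" "c a \<noteq> 0" by blast
    have "s < a" using a T(2) G by auto
    also have "a \<le> c a * a" using a(3) by simp
    also have "c a * a \<le> z" unfolding zsum using T(1) a(1) by (intro member_le_sum) auto
    finally show ?thesis by simp
  next
    case False
    then have "m dvd c a * a" if "a \<in> T" for a using that by (cases "a = m") auto
    then show ?thesis unfolding zsum by (auto intro: dvd_sum)
  qed
qed

text \<open>
  The vector \<open>w\<close> is left arbitrary because the formula is needed twice: for the vector of
  generators, and for the columns of the matrix that carries out the column operation.
\<close>

lemma rf_row_sum:
  fixes w :: "nat \<Rightarrow> int"
  assumes m: "m \<ge> 2" and s: "s = k * m" and i: "i < m"
  shows "(\<Sum>j<m. rf_entry m s (i + 1) (j + 1) * w j) =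
    (if i = 0 then w (m - 1) - w 0
     else if i = 1 then 2 * int k * w 0 - w 1
     else int k * w 0 + w (i - 1) - w i)"
proof -
  have div: "int (2 * s) div int m = 2 * int k" "int s div int m = int k"
    using m unfolding s by simp_all
  consider "i = 0" | "i = 1" | "i \<ge> 2" by linarith
  then show ?thesis
  proof cases
    case 1
    have "(\<Sum>j<m. rf_entry m s (i + 1) (j + 1) * w j) =
      (\<Sum>j<m. (if j = 0 then - w 0 else 0) + (if j = m - 1 then w (m - 1) else 0))"
      using m by (intro sum.cong) (auto simp: rf_entry_def 1)
    then show ?thesis using m 1 by (simp add: sum.distrib sum.delta)
  next
    case 2
    have "(\<Sum>j<m. rf_entry m s (i + 1) (j + 1) * w j) =
      (\<Sum>j<m. (if j = 0 then 2 * int k * w 0 else 0) + (if j = 1 then - w 1 else 0))"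
      unfolding rf_entry_def div using m by (intro sum.cong) (auto simp: 2)
    then show ?thesis using m 2 by (simp add: sum.distrib sum.delta)
  next
    case 3
    have "(\<Sum>j<m. rf_entry m s (i + 1) (j + 1) * w j) =
      (\<Sum>j<m. (if j = 0 then int k * w 0 else 0) +
        ((if j = i - 1 then w (i - 1) else 0) + (if j = i then - w i else 0)))"
      unfolding rf_entry_def div using 3 by (intro sum.cong) auto
    then show ?thesis using m i 3 by (simp add: sum.distrib sum.delta)
  qed
qed

lemma abs_det_rf_mat:
  assumes m: "m \<ge> 2" and s: "s = k * m" and k: "k > 0"
  shows "\<bar>det (rf_mat m s)\<bar> = int s - 1"
proof -
  let ?A = "rf_mat m s"
  \<comment> \<open>Right multiplication by \<open>C\<close> is the column operation. Write \<open>x\<close> for its first column, with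
    \<open>x 0 = 1\<close> so that the operation preserves the determinant. Clearing row \<open>1\<close> (counted from \<open>0\<close>)
    forces \<open>x 1 = 2 * k\<close>, and clearing row \<open>i \<ge> 2\<close> forces \<open>x i = x (i - 1) + k\<close>.\<close>
  define C :: "int mat" where
    "C = mat m m (\<lambda>(l, j). if l = j then 1 else if j = 0 then int (l + 1) * int k else 0)"
  define T where "T = ?A * C"
  have A: "?A \<in> carrier_mat m m" by (simp add: rf_mat_def)
  have C: "C \<in> carrier_mat m m" by (simp add: C_def)
  have T: "T \<in> carrier_mat m m" unfolding T_def using A C by simp
  have T_entry: "T $$ (i, j) =
      (if i = 0 then C $$ (m - 1, j) - C $$ (0, j)
       else if i = 1 then 2 * int k * C $$ (0, j) - C $$ (1, j)
       else int k * C $$ (0, j) + C $$ (i - 1, j) - C $$ (i, j))"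
    if "i < m" "j < m" for i j
  proof -
    have "T $$ (i, j) = (\<Sum>l<m. rf_entry m s (i + 1) (l + 1) * C $$ (l, j))"
      using that A C
      by (simp add: T_def scalar_prod_def rf_mat_def atLeast0LessThan)
    then show ?thesis by (simp only: rf_row_sum[OF m s \<open>i < m\<close>])
  qed
  have "det C = prod_list (diag_mat C)"
    by (rule det_lower_triangular[OF _ C]) (auto simp: C_def)
  also have "diag_mat C = replicate m 1"
    by (rule nth_equalityI) (auto simp: diag_mat_def C_def)
  finally have det_C: "det C = 1" by simp
  have T_col0: "T $$ (i, 0) = (if i = 0 then int s - 1 else 0)" if "i < m" for i
    using that m s by (auto simp: T_entry C_def of_nat_diff algebra_simps)
  let ?M = "mat_delete T 0 0"
  have M: "?M \<in> carrier_mat (m - 1) (m - 1)" using T by (simp add: mat_delete_def)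
  have M_entry: "?M $$ (i, j) = T $$ (i + 1, j + 1)" if "i < m - 1" "j < m - 1" for i j
    using that T by (simp add: mat_delete_def)
  have "det ?M = prod_list (diag_mat ?M)"
    by (rule det_lower_triangular[OF _ M]) (auto simp: M_entry T_entry C_def)
  also have "diag_mat ?M = replicate (m - 1) (-1)"
    using M by (intro nth_equalityI) (auto simp: diag_mat_def M_entry T_entry C_def)
  finally have det_M: "det ?M = (-1) ^ (m - 1)" by simp
  have "det T = (\<Sum>i<m. T $$ (i, 0) * cofactor T i 0)"
    using laplace_expansion_column[OF T, of 0] m by simp
  also have "\<dots> = (\<Sum>i<m. if i = 0 then (int s - 1) * cofactor T 0 0 else 0)"
    by (rule sum.cong) (auto simp: T_col0)
  also have "\<dots> = (int s - 1) * (-1) ^ (m - 1)"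
    using m by (simp add: cofactor_def det_M)
  finally have "det T = (int s - 1) * (-1) ^ (m - 1)" .
  moreover have "det T = det ?A" unfolding T_def using det_mult[OF A C] det_C by simp
  moreover have "s \<ge> 1" using k m s by simp
  ultimately show ?thesis by (simp add: abs_mult power_abs)
qed

theorem corollary4p3:
  fixes m s :: nat and S :: "nat set" and A :: "int mat"
  assumes "m \<ge> 2"
    and "S = \<langle>{m} \<union> {s + 1..s + m - 1}\<rangle>"
    and "numerical_semigroup S"
    and "Arf S"
    and "multiplicity_of S = m"
    and "conductor S = int s"
    and "[s = 0] (mod m)"
    and "A = rf_mat m s"
  shows "row_factorization_matrix S A \<and> \<bar>det A\<bar> = int s - 1"
proof
  let ?G = "{m} \<union> {s + 1..s + m - 1}"
  note m = assms(1)
  have m_le: "m \<le> x" if "x \<in> S" "x \<noteq> 0" for x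
    using that assms(5) unfolding multiplicity_of_def by (metis (mono_tags, lifting) Least_le)
  obtain k where s: "s = k * m"
    using assms(7) by (auto simp: cong_0_iff dvd_def mult.commute)
  have k: "k > 0"
  proof (rule ccontr)
    assume "\<not> k > 0"
    then have "1 \<in> ?G" using s m by auto
    then have "1 \<in> S" using assms(2) generated_superset by blast
    from m_le[OF this] m show False by simp
  qed
  have s_ge: "m \<le> s" using k s by simp
  show "\<bar>det A\<bar> = int s - 1" using abs_det_rf_mat[OF m s k] assms(8) by simp

  have gap: "m dvd z \<or> s < z" if "z \<in> S" for z
    by (rule generated_dvd_or_greater[OF that[unfolded assms(2)]]) simp
  have minimal: "minimal_generating_set ?G S"
  proof (rule minimal_generating_setI_atoms)
    fix g x y assume g: "g \<in> ?G" and xy: "x \<in> S" "y \<in> S" "g = x + y"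
    show "x = 0 \<or> y = 0"
    proof (rule ccontr)
      assume "\<not> (x = 0 \<or> y = 0)"
      then have ge: "m \<le> x" "m \<le> y" using xy m_le by auto
      have small: "g < s + m" using g m s_ge by auto
      have "m dvd x \<or> s < x" "m dvd y \<or> s < y"
        using gap xy(1,2) by blast+
      moreover have "\<not> s < x" "\<not> s < y" using small ge xy(3) by linarith+
      ultimately have "m dvd g" unfolding xy(3) by (blast intro: dvd_add)
      have "g = m"
      proof (rule ccontr)
        assume "g \<noteq> m"
        then have "0 < g - s" "g - s < m" using g small by auto
        moreover have "m dvd g - s" using \<open>m dvd g\<close> s by (simp add: dvd_diff_nat)
        ultimately show False by (simp add: nat_dvd_not_less)
      qed
      with ge xy(3) m show False by simp
    qed
  qed (use assms(2) m in auto)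

  define ns where "ns = m # [s + 1..<s + m]"
  have len: "length ns = m" using m by (simp add: ns_def)
  have nth: "ns ! j = (if j = 0 then m else s + j)" if "j < m" for j
    using that by (cases j) (auto simp: ns_def)
  have "set ns = ?G" using m by (auto simp: ns_def)
  then have min_ns: "minimal_generating_set (set ns) S" using minimal by simp
  have sorted: "sorted_wrt (<) ns" using s_ge by (auto simp: ns_def)
  have frob: "frobenius_number S = int s - 1" using assms(6) by (simp add: conductor_def)
  have rows: "frobenius_number S = (\<Sum>j<m. A $$ (i, j) * int (ns ! j))" if "i < m" for i
  proof -
    have "(\<Sum>j<m. A $$ (i, j) * int (ns ! j)) =
      (\<Sum>j<m. rf_entry m s (i + 1) (j + 1) * int (ns ! j))"
      using that assms(8) by (intro sum.cong) (auto simp: rf_mat_def)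
    also have "\<dots> = int s - 1"
      unfolding rf_row_sum[OF m s that] using that m by (auto simp: nth s of_nat_diff)
    finally show ?thesis using frob by simp
  qed
  have "A $$ (i, i) = -1" if "i < m" for i
    using that assms(8) by (simp add: rf_mat_def rf_entry_def)
  moreover have "A $$ (i, j) \<ge> 0" if "i < m" "j < m" "i \<noteq> j" for i j
    using that assms(8) m by (auto simp: rf_mat_def rf_entry_def pos_imp_zdiv_nonneg_iff)
  moreover have "A \<in> carrier_mat m m" using assms(8) by (simp add: rf_mat_def)
  ultimately show "row_factorization_matrix S A"
    unfolding row_factorization_matrix_def using len sorted min_ns rows
    by (intro exI[of _ ns]) auto
qed

end
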